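(* Fix $c \in \mathbb{Z}^+$ and a deletion probability $q$ with $q < \frac{c}{c+1}$. There exists a finite constant $C$, depending only on $c$ and $q$, such that for any integer $k > c$ the following holds: in the TED deletion model, $T=\exp(C k\log_k n)$ independent traces suffice to reconstruct the binary labels of a complete $k$-ary tree on $n$ nodes with high probability. That is, there is an estimator which, given the tree topology, $q$, and $T$ independent TED traces of the labeled tree $X$, outputs the labeling of $X$ with probability tending to $1$ as $n\to\infty$.
   Context: Tree trace reconstruction: $X$ is a rooted tree of known topology whose $n$ non-root nodes carry unknown binary labels; the children of every node have a left-to-right order. A complete $k$-ary tree is a rooted tree in which every non-leaf node has exactly $k$ children (all leaves at the same depth). TED (Tree Edit Distance) deletion model with parameter $q$: each non-root node is deleted independently with probability $q$ (the root is never deleted); deletions are associative, and when a node $v$ is deleted, all of its children become children of the parent of $v$ (equivalently, the edge between $v$ and its parent is contracted, keeping the parent's label), taking the place of $v$ in the left-to-right order among the parent's children (surviving original siblings left of $v$ stay to the left of $v$'s children, those right of $v$ stay to the right). The resulting labeled ordered rooted tree is a trace. The goal is to recover the labels of $X$ from independent traces, knowing only the deletion model, $q$, and the topology of $X$; "with high probability" means with probability tending to $1$ as $n \to \infty$. *)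

theory Defs
  imports "HOL-Probability.Probability_Mass_Function"
begin

text \<open>
  Ordered rooted trees. Only non-root nodes carry a label, so the root has its own constructor;
  the children of a node are listed from left to right.
\<close>

datatype 'a vtree = Vertex 'a "'a vtree list"

datatype 'a rtree = Root (children: "'a vtree list")

definition tree_topology :: "'a rtree \<Rightarrow> unit rtree" where
  "tree_topology = map_rtree (\<lambda>_. ())"

fun forest_size :: "'a vtree list \<Rightarrow> nat" where
  "forest_size [] = 0"
| "forest_size (Vertex a us # ts) = 1 + forest_size us + forest_size ts"

definition num_nonroot :: "'a rtree \<Rightarrow> nat" where
  "num_nonroot X = forest_size (children X)"

text \<open>
  \<open>kary_forest k d ts\<close>: a node with child list \<open>ts\<close> is the root of a complete \<open>k\<close>-ary tree
  all of whose leaves are exactly \<open>d\<close> levels below it.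
\<close>

fun kary_forest :: "nat \<Rightarrow> nat \<Rightarrow> 'a vtree list \<Rightarrow> bool" where
  "kary_forest k 0 ts \<longleftrightarrow> ts = []"
| "kary_forest k (Suc d) ts \<longleftrightarrow>
     length ts = k \<and> (\<forall>a us. Vertex a us \<in> set ts \<longrightarrow> kary_forest k d us)"

definition complete_kary :: "nat \<Rightarrow> 'a rtree \<Rightarrow> bool" where
  "complete_kary k X \<longleftrightarrow> (\<exists>d. kary_forest k d (children X))"

text \<open>
  Tree Edit Distance deletions below a node that is kept. Every vertex draws its own independent
  coin, which is \<open>True\<close> (delete) with probability \<open>q\<close>. A deleted vertex is replaced, at its
  position among its siblings, by the list of its children, which are themselves already the
  result of the deletions further down; as deletions are associative, the order in which the
  vertices are processed is immaterial.
\<close>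

fun ted_forest :: "real \<Rightarrow> 'a vtree list \<Rightarrow> 'a vtree list pmf" where
  "ted_forest q [] = return_pmf []"
| "ted_forest q (Vertex a us # ts) =
     do {
       del \<leftarrow> bernoulli_pmf q;
       us' \<leftarrow> ted_forest q us;
       ts' \<leftarrow> ted_forest q ts;
       return_pmf ((if del then us' else [Vertex a us']) @ ts')
     }"

definition ted_trace :: "real \<Rightarrow> 'a rtree \<Rightarrow> 'a rtree pmf" where
  "ted_trace q X = map_pmf Root (ted_forest q (children X))"

end

theory Submission
  imports Defs "HOL-Library.Sublist" "HOL-Probability.Product_PMF"
begin

text \<open>
  Deletions never increase depth, so a vertex at depth \<open>d\<close> of a trace of a complete tree of
  depth \<open>d\<close> is an original leaf none of whose ancestors was deleted. Hence the vertices of a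
  trace that have a descendant at depth \<open>d\<close> are exactly the vertices lying on surviving
  root-to-leaf paths, at their original depth and in their original order. Surviving paths
  form a branching process whose mean offspring \<open>k (1 - q) \<ge> (c + 1) (1 - q)\<close> exceeds \<open>1\<close>, so
  each vertex reaches depth \<open>d\<close> with probability at least some \<open>\<theta> > 0\<close> depending on \<open>c\<close> and \<open>q\<close>
  only. With probability at least \<open>((1 - q) \<theta>) ^ (k d)\<close> every vertex on a prescribed
  root-to-leaf path therefore has all of its \<open>k\<close> children on surviving paths. This can be seen
  in the trace, and it reveals where the prescribed path is, so any labelling that could
  have produced the trace has the true labels on that path. A union bound over the at most \<open>n\<close>
  paths shows that \<open>exp (C k log\<^sub>k n)\<close> traces suffice to see every path at least once.
\<close>

section \<open>Complete trees and their paths\<close>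

primrec label :: "'a vtree \<Rightarrow> 'a" where
  "label (Vertex a us) = a"

primrec subforest :: "'a vtree \<Rightarrow> 'a vtree list" where
  "subforest (Vertex a us) = us"

lemma Vertex_label_subforest: "Vertex (label t) (subforest t) = t"
  by (cases t) simp

lemma subforest_map_vtree: "subforest (map_vtree f t) = map (map_vtree f) (subforest t)"
  by (cases t) simp

lemma kary_forest_Suc_iff [simp]:
  "kary_forest k (Suc d) ts \<longleftrightarrow> length ts = k \<and> (\<forall>t\<in>set ts. kary_forest k d (subforest t))"
  by (metis Vertex_label_subforest kary_forest.simps(2) subforest.simps)

declare kary_forest.simps(2) [simp del]

lemma kary_forest_subforest_nth:
  assumes "kary_forest k (Suc d) ts" "j < k"
  shows "kary_forest k d (subforest (ts ! j))"
  using assms by simp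

lemma kary_forest_map_iff: "kary_forest k d (map (map_vtree f) ts) \<longleftrightarrow> kary_forest k d ts"
  by (induction d arbitrary: ts) (simp_all add: subforest_map_vtree)

lemma children_tree_topology:
  "children (tree_topology X) = map (map_vtree (\<lambda>_. ())) (children X)"
  by (cases X) (simp add: tree_topology_def)

lemma kary_forest_topology_cong:
  assumes "tree_topology X = tree_topology Y"
  shows "kary_forest k d (children X) \<longleftrightarrow> kary_forest k d (children Y)"
  using assms kary_forest_map_iff children_tree_topology by metis

lemma forest_size_ge:
  assumes "\<And>t. t \<in> set ts \<Longrightarrow> m \<le> Suc (forest_size (subforest t))"
  shows "length ts * m \<le> forest_size ts"
  using assms by (induction ts rule: forest_size.induct) (force simp: add_mono)+

lemma kary_forest_size: "kary_forest k (Suc d) ts \<Longrightarrow> k ^ Suc d \<le> forest_size ts"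
proof (induction d arbitrary: ts)
  case 0
  then show ?case
    using forest_size_ge[of ts 1] by simp
next
  case (Suc d)
  have "k ^ Suc d \<le> Suc (forest_size (subforest t))" if "t \<in> set ts" for t
    using Suc.IH[of "subforest t"] Suc.prems that by simp
  then show ?case
    using forest_size_ge[of ts "k ^ Suc d"] Suc.prems by simp
qed

definition addresses :: "nat \<Rightarrow> nat \<Rightarrow> nat list set" where
  "addresses k d = {p. set p \<subseteq> {..<k} \<and> length p = d}"

lemma finite_addresses: "finite (addresses k d)"
  and card_addresses: "card (addresses k d) = k ^ d"
  using finite_lists_length_eq[of "{..<k}" d] card_lists_length_eq[of "{..<k}" d]
  by (simp_all add: addresses_def)

lemma length_addresses: "p \<in> addresses k d \<Longrightarrow> length p = d"
  by (simp add: addresses_def)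

lemma Cons_in_addresses_iff:
  "i # p \<in> addresses k d \<longleftrightarrow> (\<exists>e. d = Suc e \<and> i < k \<and> p \<in> addresses k e)"
  by (auto simp: addresses_def)

primrec path_labels :: "nat list \<Rightarrow> 'a vtree list \<Rightarrow> 'a list" where
  "path_labels [] ts = []"
| "path_labels (i # p) ts = label (ts ! i) # path_labels p (subforest (ts ! i))"

lemma kary_forest_eqI:
  assumes "kary_forest k d ts" "kary_forest k d us" "0 < k"
    and "\<And>p. p \<in> addresses k d \<Longrightarrow> path_labels p ts = path_labels p us"
  shows "ts = us"
  using assms
proof (induction d arbitrary: ts us)
  case (Suc d)
  have lengths: "length ts = k" "length us = k"
    using Suc.prems by auto
  have "ts ! i = us ! i" if i_less: "i < k" for i
  proof -
    have agree: "label (ts ! i) = label (us ! i)"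
      "path_labels p (subforest (ts ! i)) = path_labels p (subforest (us ! i))"
      if "p \<in> addresses k d" for p
      using Suc.prems(4)[of "i # p"] i_less that by (simp_all add: Cons_in_addresses_iff)
    have "replicate d 0 \<in> addresses k d"
      using \<open>0 < k\<close> by (auto simp: addresses_def)
    moreover have "subforest (ts ! i) = subforest (us ! i)"
      using kary_forest_subforest_nth[OF Suc.prems(1) i_less]
        kary_forest_subforest_nth[OF Suc.prems(2) i_less] \<open>0 < k\<close> agree(2) by (rule Suc.IH)
    ultimately show ?thesis
      using agree(1) Vertex_label_subforest by metis
  qed
  then show ?case
    by (intro nth_equalityI) (simp_all add: lengths)
qed simp

section \<open>The surviving paths of a trace\<close>

fun forest_height :: "'a vtree list \<Rightarrow> nat" where
  "forest_height [] = 0"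
| "forest_height (Vertex a us # ts) = max (Suc (forest_height us)) (forest_height ts)"

lemma forest_height_Cons [simp]:
  "forest_height (t # ts) = max (Suc (forest_height (subforest t))) (forest_height ts)"
  by (cases t) simp

lemma forest_induct [case_names Nil Cons]:
  assumes "P []" and "\<And>t ts. P (subforest t) \<Longrightarrow> P ts \<Longrightarrow> P (t # ts)"
  shows "P ts"
  using assms by (induction ts rule: forest_height.induct) (metis subforest.simps)+

lemma forest_height_append:
  "forest_height (ts @ us) = max (forest_height ts) (forest_height us)"
  by (induction ts) auto

lemma Suc_le_forest_height_iff:
  "Suc d \<le> forest_height ts \<longleftrightarrow> (\<exists>t\<in>set ts. d \<le> forest_height (subforest t))"
  by (induction ts) (auto simp: le_max_iff_disj)

lemma kary_forest_height: "kary_forest k d ts \<Longrightarrow> forest_height ts \<le> d"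
proof (induction d arbitrary: ts)
  case (Suc d)
  then have "\<forall>t\<in>set ts. forest_height (subforest t) \<le> d"
    by simp
  then show ?case
    using Suc_le_forest_height_iff[of "Suc d" ts] by (meson not_less_eq_eq)
qed simp

primrec prune :: "nat \<Rightarrow> 'a vtree list \<Rightarrow> 'a vtree list" where
  "prune 0 ts = []"
| "prune (Suc d) ts = map (\<lambda>t. Vertex (label t) (prune d (subforest t)))
     (filter (\<lambda>t. d \<le> forest_height (subforest t)) ts)"

lemma prune_append: "prune d (ts @ us) = prune d ts @ prune d us"
  by (cases d) simp_all

lemma prune_eq_Nil_iff: "prune (Suc d) ts = [] \<longleftrightarrow> forest_height ts \<le> d"
  using Suc_le_forest_height_iff[of d ts] by (auto simp: filter_empty_conv not_less_eq_eq)

primrec full_along :: "nat \<Rightarrow> nat list \<Rightarrow> 'a vtree list \<Rightarrow> bool" where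
  "full_along k [] ts \<longleftrightarrow> True"
| "full_along k (i # p) ts \<longleftrightarrow> length ts = k \<and> full_along k p (subforest (ts ! i))"

text \<open>
  The address is that of a leaf, so its length is the depth of the original tree.
\<close>

definition path_resolved :: "nat \<Rightarrow> nat list \<Rightarrow> 'a vtree list \<Rightarrow> bool" where
  "path_resolved k p ys \<longleftrightarrow> full_along k p (prune (length p) ys)"

lemma path_resolved_imp_height:
  assumes "path_resolved k p ys" "0 < k"
  shows "length p \<le> forest_height ys"
proof (cases p)
  case (Cons i r)
  then have "prune (Suc (length r)) ys \<noteq> []"
    using assms by (auto simp: path_resolved_def)
  then show ?thesis
    using Cons by (simp add: prune_eq_Nil_iff not_less_eq_eq del: prune.simps)
qed simp

lemma path_resolved_ConsI:
  assumes "length ys = k" "i < k" "path_resolved k p (subforest (ys ! i))"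
    and "\<And>j. j < k \<Longrightarrow> length p \<le> forest_height (subforest (ys ! j))"
  shows "path_resolved k (i # p) ys"
proof -
  have "filter (\<lambda>y. length p \<le> forest_height (subforest y)) ys = ys"
    using assms(1,4) by (intro filter_True) (auto simp: in_set_conv_nth)
  then show ?thesis
    using assms(1-3) by (simp add: path_resolved_def)
qed

lemma set_ted_forest_Cons:
  assumes "ys \<in> set_pmf (ted_forest q (t # ts))"
  obtains del us' ts' where
    "us' \<in> set_pmf (ted_forest q (subforest t))" "ts' \<in> set_pmf (ted_forest q ts)"
    "ys = (if del then us' else [Vertex (label t) us']) @ ts'"
  using assms by (cases t) (auto cong: if_cong)

lemma forest_height_trace:
  "ys \<in> set_pmf (ted_forest q ts) \<Longrightarrow> forest_height ys \<le> forest_height ts"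
proof (induction ts arbitrary: ys rule: forest_induct)
  case (Cons t ts)
  from Cons.prems obtain del us' ts' where trace:
    "us' \<in> set_pmf (ted_forest q (subforest t))" "ts' \<in> set_pmf (ted_forest q ts)"
    "ys = (if del then us' else [Vertex (label t) us']) @ ts'"
    by (rule set_ted_forest_Cons)
  have "forest_height us' \<le> forest_height (subforest t)" "forest_height ts' \<le> forest_height ts"
    using Cons.IH trace by blast+
  then show ?case
    using trace(3) by (auto simp: forest_height_append)
qed simp

definition pruned_trace_of :: "real \<Rightarrow> nat \<Rightarrow> 'a vtree \<Rightarrow> 'a vtree \<Rightarrow> bool" where
  "pruned_trace_of q d y t \<longleftrightarrow>
     (\<exists>us\<in>set_pmf (ted_forest q (subforest t)). y = Vertex (label t) (prune d us))"

lemma list_emb_prune_trace: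
  assumes "ys \<in> set_pmf (ted_forest q ts)" "forest_height ts \<le> Suc d"
  shows "list_emb (pruned_trace_of q d) (prune (Suc d) ys) ts"
  using assms
proof (induction ts arbitrary: ys)
  case (Cons t ts)
  from Cons.prems(1) obtain del us' ts' where trace:
    "us' \<in> set_pmf (ted_forest q (subforest t))" "ts' \<in> set_pmf (ted_forest q ts)"
    "ys = (if del then us' else [Vertex (label t) us']) @ ts'"
    by (rule set_ted_forest_Cons)
  have "forest_height ts \<le> Suc d" "forest_height (subforest t) \<le> d"
    using Cons.prems(2) by simp_all
  then have "list_emb (pruned_trace_of q d) (prune (Suc d) ts') ts" "prune (Suc d) us' = []"
    using Cons.IH[OF trace(2)] forest_height_trace[OF trace(1)]
    by (auto simp: prune_eq_Nil_iff simp del: prune.simps)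
  moreover have "pruned_trace_of q d (Vertex (label t) (prune d us')) t"
    using trace(1) by (auto simp: pruned_trace_of_def)
  ultimately show ?case
    using trace(3) by (auto simp: prune_append)
qed simp

lemma list_emb_same_length:
  assumes "list_emb P xs ys" "length xs = length ys"
  shows "list_all2 P xs ys"
  using assms by (induction rule: list_emb.induct) (auto dest: list_emb_length)

lemma path_labels_prune_trace:
  assumes "ys \<in> set_pmf (ted_forest q ts)" "kary_forest k d ts" "p \<in> addresses k d"
    and "path_resolved k p ys"
  shows "path_labels p (prune d ys) = path_labels p ts"
  using assms
proof (induction p arbitrary: d ts ys)
  case (Cons i p)
  obtain e where d_Suc: "d = Suc e" and i_less: "i < k" and p_address: "p \<in> addresses k e"
    using Cons.prems(3) by (auto simp: Cons_in_addresses_iff)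
  have lengths: "length ts = k" "length (prune d ys) = k"
    using Cons.prems d_Suc length_addresses[OF p_address] by (auto simp: path_resolved_def)
  have "list_all2 (pruned_trace_of q e) (prune d ys) ts"
    using list_emb_prune_trace[OF Cons.prems(1)] kary_forest_height[OF Cons.prems(2)] lengths
    unfolding d_Suc by (intro list_emb_same_length) auto
  then obtain us where survivor: "us \<in> set_pmf (ted_forest q (subforest (ts ! i)))"
    "prune d ys ! i = Vertex (label (ts ! i)) (prune e us)"
    using i_less lengths by (auto simp: list_all2_conv_all_nth pruned_trace_of_def)
  moreover have "path_resolved k p us"
    using Cons.prems(4) survivor(2) d_Suc length_addresses[OF p_address]
    by (simp add: path_resolved_def)
  then have "path_labels p (prune e us) = path_labels p (subforest (ts ! i))"
    using Cons.prems(2) survivor(1) i_less p_address d_Suc kary_forest_subforest_nth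
    by (intro Cons.IH) auto
  ultimately show ?case
    by simp
qed simp

section \<open>The estimator\<close>

definition feasible_estimator :: "real \<Rightarrow> unit rtree \<Rightarrow> 'a rtree list \<Rightarrow> 'a rtree" where
  "feasible_estimator q S Ys =
     (SOME X. tree_topology X = S \<and> set Ys \<subseteq> set_pmf (ted_trace q X))"

lemma feasible_estimator_eqI:
  assumes kary: "kary_forest k d (children X)" and "0 < k"
    and feasible: "set Ys \<subseteq> set_pmf (ted_trace q X)"
    and resolved: "\<And>p. p \<in> addresses k d \<Longrightarrow> \<exists>Y\<in>set Ys. path_resolved k p (children Y)"
  shows "feasible_estimator q (tree_topology X) Ys = X"
  unfolding feasible_estimator_def
proof (rule some_equality)
  fix Z assume Z_feasible: "tree_topology Z = tree_topology X \<and> set Ys \<subseteq> set_pmf (ted_trace q Z)"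
  then have kary_Z: "kary_forest k d (children Z)"
    using kary kary_forest_topology_cong by blast
  have "children Z = children X"
    using kary_Z kary \<open>0 < k\<close>
  proof (rule kary_forest_eqI)
    fix p assume p_address: "p \<in> addresses k d"
    then obtain Y where Y_resolved: "Y \<in> set Ys" "path_resolved k p (children Y)"
      using resolved by blast
    then have "children Y \<in> set_pmf (ted_forest q (children X))"
      "children Y \<in> set_pmf (ted_forest q (children Z))"
      using feasible Z_feasible by (auto simp: ted_trace_def)
    then show "path_labels p (children Z) = path_labels p (children X)"
      using path_labels_prune_trace kary kary_Z p_address Y_resolved(2) by metis
  qed
  then show "Z = X"
    by (simp add: rtree.expand)
qed (use feasible in simp)

section \<open>The probability that a path is resolved\<close>

lemma prob_pair_pmf_Times:
  "measure_pmf.prob (pair_pmf M N) (A \<times> B) = measure_pmf.prob M A * measure_pmf.prob N B"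
proof -
  have "measure_pmf.prob (pair_pmf M N) ((A \<inter> set_pmf M) \<times> (B \<inter> set_pmf N))
      = measure_pmf.prob M (A \<inter> set_pmf M) * measure_pmf.prob N (B \<inter> set_pmf N)"
    by (intro measure_pmf_prob_product) auto
  moreover have "(A \<inter> set_pmf M) \<times> (B \<inter> set_pmf N) = (A \<times> B) \<inter> set_pmf (pair_pmf M N)"
    by auto
  ultimately show ?thesis
    by (simp only: measure_Int_set_pmf)
qed

lemma ted_forest_Cons_conv_pair:
  "ted_forest q (t # ts) =
     map_pmf (\<lambda>(us, vs). us @ vs) (pair_pmf (ted_forest q [t]) (ted_forest q ts))"
  by (cases t) (simp add: pair_pmf_def map_pmf_def bind_assoc_pmf bind_return_pmf)

lemma prob_ted_forest_Cons:
  "measure_pmf.prob (ted_forest q (t # ts)) E =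
     measure_pmf.prob (pair_pmf (ted_forest q [t]) (ted_forest q ts)) {(us, vs). us @ vs \<in> E}"
  unfolding ted_forest_Cons_conv_pair[of q t ts]
  by (auto simp: vimage_def intro: arg_cong[where f = "measure_pmf.prob _"])

lemma prob_root_kept:
  assumes "0 \<le> q" "q \<le> 1"
  shows "(1 - q) * measure_pmf.prob (ted_forest q (subforest t)) A
    \<le> measure_pmf.prob (ted_forest q [t]) {[Vertex (label t) us] | us. us \<in> A}"
proof -
  let ?splice = "\<lambda>(del, us). if del then us else [Vertex (label t) us]"
  let ?P = "pair_pmf (bernoulli_pmf q) (ted_forest q (subforest t))"
  have "(1 - q) * measure_pmf.prob (ted_forest q (subforest t)) A
      = measure_pmf.prob ?P ({False} \<times> A)"
    using assms by (simp add: prob_pair_pmf_Times measure_pmf_single)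
  also have "\<dots> \<le> measure_pmf.prob ?P (?splice -` {[Vertex (label t) us] | us. us \<in> A})"
    by (intro measure_pmf.finite_measure_mono) auto
  also have "map_pmf ?splice ?P = ted_forest q [t]"
    by (cases t) (simp add: pair_pmf_def map_pmf_def bind_assoc_pmf bind_return_pmf cong: if_cong)
  then have "measure_pmf.prob ?P (?splice -` {[Vertex (label t) us] | us. us \<in> A})
      = measure_pmf.prob (ted_forest q [t]) {[Vertex (label t) us] | us. us \<in> A}"
    by (metis measure_map_pmf)
  finally show ?thesis .
qed

lemma prob_all_roots_kept:
  assumes q_bounds: "0 \<le> q" "q \<le> 1"
  shows "(\<Prod>j<length ts. (1 - q) * measure_pmf.prob (ted_forest q (subforest (ts ! j))) (A j))
    \<le> measure_pmf.prob (ted_forest q ts)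
        {ys. length ys = length ts \<and> (\<forall>j<length ts. subforest (ys ! j) \<in> A j)}"
proof (induction ts arbitrary: A)
  case (Cons t ts)
  let ?root_kept = "{[Vertex (label t) us] | us. us \<in> A 0}"
  let ?rest_kept = "{ys. length ys = length ts \<and> (\<forall>j<length ts. subforest (ys ! j) \<in> A (Suc j))}"
  let ?all_kept = "{ys. length ys = length (t # ts) \<and>
    (\<forall>j<length (t # ts). subforest (ys ! j) \<in> A j)}"
  have "(\<Prod>j<length (t # ts).
      (1 - q) * measure_pmf.prob (ted_forest q (subforest ((t # ts) ! j))) (A j)) =
    (1 - q) * measure_pmf.prob (ted_forest q (subforest t)) (A 0) *
      (\<Prod>j<length ts.
        (1 - q) * measure_pmf.prob (ted_forest q (subforest (ts ! j))) (A (Suc j)))"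
    unfolding length_Cons prod.lessThan_Suc_shift by simp
  also have "\<dots> \<le> measure_pmf.prob (ted_forest q [t]) ?root_kept *
      measure_pmf.prob (ted_forest q ts) ?rest_kept"
    using q_bounds by (intro mult_mono prob_root_kept Cons.IH prod_nonneg) auto
  also have "\<dots> \<le> measure_pmf.prob (ted_forest q (t # ts)) ?all_kept"
    unfolding prob_ted_forest_Cons[of q t ts] prob_pair_pmf_Times[symmetric]
    by (intro measure_pmf.finite_measure_mono) (auto simp: nth_Cons split: nat.splits)
  finally show ?case .
qed simp

lemma prob_forest_height_le:
  assumes q_bounds: "0 \<le> q" "q \<le> 1"
  shows "measure_pmf.prob (ted_forest q ts) {ys. forest_height ys \<le> d}
    \<le> (\<Prod>j<length ts. 1 - (1 - q) *
          measure_pmf.prob (ted_forest q (subforest (ts ! j))) {us. d \<le> forest_height us})"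
proof (induction ts)
  case (Cons t ts)
  let ?deep = "{us. d \<le> forest_height us}"
  let ?shallow = "{ys. forest_height ys \<le> d}"
  let ?root_survives = "\<lambda>t. (1 - q) * measure_pmf.prob (ted_forest q (subforest t)) ?deep"
  have both_shallow: "{(us, vs). us @ vs \<in> ?shallow} = ?shallow \<times> ?shallow"
    by (auto simp: forest_height_append)
  have "measure_pmf.prob (ted_forest q (t # ts)) ?shallow =
      measure_pmf.prob (ted_forest q [t]) ?shallow * measure_pmf.prob (ted_forest q ts) ?shallow"
    unfolding prob_ted_forest_Cons[of q t ts] both_shallow by (rule prob_pair_pmf_Times)
  also have "\<dots> \<le> (1 - ?root_survives t) * (\<Prod>j<length ts. 1 - ?root_survives (ts ! j))"
  proof (intro mult_mono Cons.IH)
    have "?root_survives t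
        \<le> measure_pmf.prob (ted_forest q [t]) {[Vertex (label t) us] | us. us \<in> ?deep}"
      using q_bounds by (rule prob_root_kept)
    also have "\<dots> \<le> measure_pmf.prob (ted_forest q [t]) (UNIV - ?shallow)"
      by (intro measure_pmf.finite_measure_mono) auto
    finally show "measure_pmf.prob (ted_forest q [t]) ?shallow \<le> 1 - ?root_survives t"
      using measure_pmf.prob_compl[of ?shallow "ted_forest q [t]"] by simp
  qed (use q_bounds in \<open>auto simp: mult_le_one\<close>)
  also have "\<dots> = (\<Prod>j<length (t # ts). 1 - ?root_survives ((t # ts) ! j))"
    unfolding length_Cons prod.lessThan_Suc_shift by simp
  finally show ?case .
qed simp

lemma prob_path_resolved_Cons:
  assumes q_bounds: "0 \<le> q" "q \<le> 1" and k_children: "length ts = k" "i < k"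
  shows "(1 - q) ^ k *
      measure_pmf.prob (ted_forest q (subforest (ts ! i))) {us. path_resolved k p us} *
      (\<Prod>j\<in>{..<k} - {i}. measure_pmf.prob (ted_forest q (subforest (ts ! j)))
        {us. length p \<le> forest_height us})
    \<le> measure_pmf.prob (ted_forest q ts) {ys. path_resolved k (i # p) ys}"
proof -
  define A :: "nat \<Rightarrow> 'a vtree list set" where
    "A j = (if j = i then {us. path_resolved k p us} else {us. length p \<le> forest_height us})" for j
  let ?P = "\<lambda>j. measure_pmf.prob (ted_forest q (subforest (ts ! j))) (A j)"
  have "(1 - q) ^ k * ?P i * (\<Prod>j\<in>{..<k} - {i}. ?P j) = (\<Prod>j<k. (1 - q) * ?P j)"
    using k_children by (simp add: prod.distrib prod.remove[of "{..<k}" i])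
  also have "\<dots> \<le> measure_pmf.prob (ted_forest q ts)
      {ys. length ys = k \<and> (\<forall>j<k. subforest (ys ! j) \<in> A j)}"
    using prob_all_roots_kept[OF q_bounds, of ts A] k_children by simp
  also have "\<dots> \<le> measure_pmf.prob (ted_forest q ts) {ys. path_resolved k (i # p) ys}"
  proof (intro measure_pmf.finite_measure_mono subsetI CollectI)
    fix ys assume "ys \<in> {ys. length ys = k \<and> (\<forall>j<k. subforest (ys ! j) \<in> A j)}"
    then show "path_resolved k (i # p) ys"
      using k_children path_resolved_imp_height[of k p]
      by (intro path_resolved_ConsI) (auto simp: A_def split: if_splits)
  qed simp
  finally show ?thesis
    by (simp add: A_def)
qed

section \<open>Supercritical survival of paths\<close>

lemma one_minus_power_le_inverse:
  fixes x :: real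
  assumes "0 \<le> x" "x \<le> 1"
  shows "(1 - x) ^ m \<le> 1 / (1 + real m * x)"
proof -
  have "(1 - x) ^ m * (1 + real m * x) \<le> (1 - x) ^ m * (1 + x) ^ m"
    using assms Bernoulli_inequality[of x m] by (intro mult_left_mono) auto
  also have "\<dots> = (1 - x\<^sup>2) ^ m"
    by (simp flip: power_mult_distrib add: algebra_simps power2_eq_square)
  also have "\<dots> \<le> 1"
    using assms by (intro power_le_one) (auto simp: power_le_one)
  finally show ?thesis
    using assms by (simp add: field_simps add_pos_nonneg)
qed

locale supercritical_deletion =
  fixes m :: nat and q :: real
  assumes q_nonneg: "0 \<le> q" and supercritical: "1 < real m * (1 - q)"
begin

lemma q_less_1: "q < 1"
  using supercritical by (smt (verit) mult_nonneg_nonpos of_nat_0_le_iff)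

lemma m_gt_1: "1 < m"
proof -
  have "real m * (1 - q) \<le> real m"
    using q_nonneg by (simp add: mult_left_le)
  then show ?thesis
    using supercritical by simp
qed

text \<open>
  The value of \<open>\<theta>\<close> is chosen so that the bound \<open>(1 - x) ^ m \<le> 1 / (1 + m x)\<close> at \<open>x = (1 - q) \<theta>\<close>
  is exactly \<open>1 - \<theta>\<close>.
\<close>

definition \<theta> :: real where "\<theta> = 1 - 1 / (real m * (1 - q))"

definition \<alpha> :: real where "\<alpha> = (1 - q) * \<theta>"

lemma \<theta>_pos: "0 < \<theta>" and \<theta>_le_1: "\<theta> \<le> 1"
  using supercritical by (auto simp: \<theta>_def)

lemma \<alpha>_pos: "0 < \<alpha>" and \<alpha>_le_1: "\<alpha> \<le> 1"
  using q_nonneg q_less_1 \<theta>_pos \<theta>_le_1 by (auto simp: \<alpha>_def mult_le_one)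

lemma one_minus_\<alpha>_power_le:
  assumes "m \<le> k"
  shows "(1 - \<alpha>) ^ k \<le> 1 - \<theta>"
proof -
  have "(1 - \<alpha>) ^ k \<le> (1 - \<alpha>) ^ m"
    using \<alpha>_pos \<alpha>_le_1 assms by (intro power_decreasing) auto
  also have "\<dots> \<le> 1 / (1 + real m * \<alpha>)"
    using \<alpha>_pos \<alpha>_le_1 by (intro one_minus_power_le_inverse) auto
  also have "1 + real m * \<alpha> = real m * (1 - q)"
    using m_gt_1 q_less_1 by (simp add: \<alpha>_def \<theta>_def field_simps)
  finally show ?thesis
    by (simp add: \<theta>_def)
qed

lemma prob_survival:
  assumes "m \<le> k" "kary_forest k d ts"
  shows "\<theta> \<le> measure_pmf.prob (ted_forest q ts) {ys. d \<le> forest_height ys}"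
  using assms(2)
proof (induction d arbitrary: ts)
  case 0
  then show ?case
    using \<theta>_le_1 by simp
next
  case (Suc d)
  let ?shallow = "{ys :: 'a vtree list. forest_height ys \<le> d}"
  have "\<theta> \<le> measure_pmf.prob (ted_forest q (subforest (ts ! j))) {us. d \<le> forest_height us}"
    if "j < k" for j
    using Suc.IH kary_forest_subforest_nth[OF Suc.prems that] .
  then have factor_le: "1 - (1 - q) *
      measure_pmf.prob (ted_forest q (subforest (ts ! j))) {us. d \<le> forest_height us} \<le> 1 - \<alpha>"
    if "j < k" for j
    using that q_less_1 by (simp add: \<alpha>_def)
  have "measure_pmf.prob (ted_forest q ts) ?shallow \<le> (\<Prod>j<k. 1 - (1 - q) *
      measure_pmf.prob (ted_forest q (subforest (ts ! j))) {us. d \<le> forest_height us})"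
    using prob_forest_height_le[of q ts d] q_nonneg q_less_1 Suc.prems by simp
  also have "\<dots> \<le> (\<Prod>j<k. 1 - \<alpha>)"
    using q_nonneg q_less_1 factor_le by (intro prod_mono) (auto simp: mult_le_one)
  also have "\<dots> \<le> 1 - \<theta>"
    using one_minus_\<alpha>_power_le[OF \<open>m \<le> k\<close>] by simp
  finally have "measure_pmf.prob (ted_forest q ts) ?shallow \<le> 1 - \<theta>" .
  moreover have "{ys. Suc d \<le> forest_height ys} = UNIV - ?shallow"
    by auto
  ultimately show ?case
    using measure_pmf.prob_compl[of ?shallow "ted_forest q ts"] by simp
qed

lemma prob_path_resolved:
  assumes "m \<le> k" "kary_forest k d ts" "p \<in> addresses k d"
  shows "\<alpha> ^ (k * d) \<le> measure_pmf.prob (ted_forest q ts) {ys. path_resolved k p ys}"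
  using assms(2,3)
proof (induction p arbitrary: d ts)
  case Nil
  then show ?case
    using length_addresses[OF Nil.prems(2)] by (simp add: path_resolved_def)
next
  case (Cons i p)
  obtain e where d_Suc: "d = Suc e" and i_less: "i < k" and p_address: "p \<in> addresses k e"
    using Cons.prems(2) by (auto simp: Cons_in_addresses_iff)
  have kary_sub: "kary_forest k e (subforest (ts ! j))" if "j < k" for j
    using kary_forest_subforest_nth Cons.prems(1) d_Suc that by blast
  let ?resolved = "measure_pmf.prob (ted_forest q (subforest (ts ! i))) {us. path_resolved k p us}"
  let ?survives = "\<lambda>j. measure_pmf.prob (ted_forest q (subforest (ts ! j)))
    {us. length p \<le> forest_height us}"
  have resolved: "\<alpha> ^ (k * e) \<le> ?resolved"
    using Cons.IH[OF kary_sub[OF i_less] p_address] .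
  have survives: "\<theta> \<le> ?survives j" if "j < k" for j
    using prob_survival[OF \<open>m \<le> k\<close> kary_sub[OF that]] length_addresses[OF p_address] by simp
  have "\<alpha> ^ (k * d) = (1 - q) ^ k * \<theta> ^ k * \<alpha> ^ (k * e)"
    by (simp add: d_Suc power_add \<alpha>_def power_mult_distrib)
  also have "\<dots> \<le> (1 - q) ^ k * \<theta> ^ (k - 1) * \<alpha> ^ (k * e)"
    using q_less_1 \<theta>_pos \<theta>_le_1 \<alpha>_pos
    by (intro mult_right_mono mult_left_mono power_decreasing) auto
  also have "\<dots> = (1 - q) ^ k * \<alpha> ^ (k * e) * (\<Prod>j\<in>{..<k} - {i}. \<theta>)"
    using i_less by simp
  also have "\<dots> \<le> (1 - q) ^ k * ?resolved * (\<Prod>j\<in>{..<k} - {i}. ?survives j)"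
    using q_less_1 \<theta>_pos \<alpha>_pos resolved survives by (intro mult_mono prod_mono prod_nonneg) auto
  also have "\<dots> \<le> measure_pmf.prob (ted_forest q ts) {ys. path_resolved k (i # p) ys}"
    using q_nonneg q_less_1 Cons.prems(1) d_Suc i_less by (intro prob_path_resolved_Cons) auto
  finally show ?case .
qed

end

section \<open>The number of traces\<close>

lemma prob_replicate_pmf_subset:
  "measure_pmf.prob (replicate_pmf T M) {xs. set xs \<subseteq> A} = measure_pmf.prob M A ^ T"
proof (induction T)
  case (Suc T)
  have "replicate_pmf (Suc T) M = map_pmf (\<lambda>(x, xs). x # xs) (pair_pmf M (replicate_pmf T M))"
    by (simp add: pair_pmf_def map_pmf_def bind_assoc_pmf bind_return_pmf)
  moreover have "(\<lambda>(x, xs). x # xs) -` {xs. set xs \<subseteq> A} = A \<times> {xs. set xs \<subseteq> A}"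
    by auto
  ultimately show ?case
    using Suc by (simp add: prob_pair_pmf_Times)
qed simp

lemma prob_replicate_pmf_avoids_le:
  assumes "r \<le> measure_pmf.prob M A"
  shows "measure_pmf.prob (replicate_pmf T M) {xs. set xs \<inter> A = {}} \<le> exp (- (r * real T))"
proof -
  have "measure_pmf.prob (replicate_pmf T M) {xs. set xs \<inter> A = {}}
      = measure_pmf.prob M (UNIV - A) ^ T"
    unfolding prob_replicate_pmf_subset[symmetric]
    by (intro arg_cong[where f = "measure_pmf.prob _"]) auto
  also have "\<dots> \<le> exp (- r) ^ T"
  proof (intro power_mono)
    show "measure_pmf.prob M (UNIV - A) \<le> exp (- r)"
      using measure_pmf.prob_compl[of A M] exp_minus_ge[of r] assms by simp
  qed simp
  also have "\<dots> = exp (- (r * real T))"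
    by (simp add: mult.commute flip: exp_of_nat_mult)
  finally show ?thesis .
qed

lemma le_power_mult_exp_log:
  fixes \<alpha> :: real
  assumes \<alpha>_bounds: "0 < \<alpha>" "\<alpha> \<le> 1" and "1 < k" "k ^ d \<le> n"
  shows "real n \<le> \<alpha> ^ (k * d) * exp ((1 - ln \<alpha>) * real k * log (real k) (real n))"
proof -
  define L where "L = log (real k) (real n)"
  have "0 < k ^ d"
    using \<open>1 < k\<close> by simp
  then have "0 < n"
    using \<open>k ^ d \<le> n\<close> by linarith
  have "real d \<le> L"
    unfolding L_def using assms(3,4)
    by (intro le_log_of_power) (simp_all flip: of_nat_power)
  have "ln (real n) = ln (real k) * L"
    using \<open>1 < k\<close> \<open>0 < n\<close> by (simp add: L_def log_def)
  also have "\<dots> \<le> real k * L"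
    using \<open>1 < k\<close> \<open>real d \<le> L\<close> ln_le_minus_one[of "real k"] by (intro mult_right_mono) auto
  also have "\<dots> \<le> ln \<alpha> * real (k * d) + (1 - ln \<alpha>) * real k * L"
  proof -
    have "ln \<alpha> * (real k * L) \<le> ln \<alpha> * real (k * d)"
      using \<alpha>_bounds \<open>real d \<le> L\<close> by (intro mult_left_mono_neg) (auto intro: mult_left_mono)
    then show ?thesis
      by (simp add: algebra_simps)
  qed
  finally have "real n \<le> exp (ln \<alpha> * real (k * d) + (1 - ln \<alpha>) * real k * L)"
    using \<open>0 < n\<close> by (metis exp_le_cancel_iff exp_ln of_nat_0_less_iff)
  also have "\<dots> = \<alpha> ^ (k * d) * exp ((1 - ln \<alpha>) * real k * L)"
    using \<alpha>_bounds by (simp add: exp_add mult.commute[of "ln \<alpha>"] exp_of_nat_mult del: of_nat_mult)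
  finally show ?thesis
    by (simp add: L_def)
qed

lemma tendsto_mult_exp_minus: "(\<lambda>n. real n * exp (- real n)) \<longlonglongrightarrow> 0"
  using filterlim_compose[OF tendsto_power_div_exp_0[of 1] filterlim_real_sequentially]
  by (simp add: exp_minus divide_inverse)

context supercritical_deletion
begin

lemma prob_feasible_estimator_kary_ge:
  assumes "m \<le> k" "kary_forest k d (children X)"
  shows "1 - real (k ^ d) * exp (- (\<alpha> ^ (k * d) * real T))
    \<le> measure_pmf.prob (replicate_pmf T (ted_trace q X))
        {Ys. feasible_estimator q (tree_topology X) Ys = X}"
proof -
  let ?P = "replicate_pmf T (ted_trace q X)"
  let ?success = "{Ys. feasible_estimator q (tree_topology X) Ys = X}"
  let ?resolves = "\<lambda>p. {Y :: 'a rtree. path_resolved k p (children Y)}"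
  have resolved: "\<alpha> ^ (k * d) \<le> measure_pmf.prob (ted_trace q X) (?resolves p)"
    if "p \<in> addresses k d" for p
    using prob_path_resolved[OF assms that] by (simp add: ted_trace_def vimage_def)
  have "1 - measure_pmf.prob ?P ?success = measure_pmf.prob ?P ((UNIV - ?success) \<inter> set_pmf ?P)"
    using measure_pmf.prob_compl[of ?success ?P] by (simp add: measure_Int_set_pmf)
  also have "\<dots> \<le> measure_pmf.prob ?P (\<Union>p\<in>addresses k d. {Ys. set Ys \<inter> ?resolves p = {}})"
  proof (intro measure_pmf.finite_measure_mono subsetI)
    fix Ys assume failure: "Ys \<in> (UNIV - ?success) \<inter> set_pmf ?P"
    then have "set Ys \<subseteq> set_pmf (ted_trace q X)"
      by (auto simp: set_replicate_pmf)
    moreover have "0 < k"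
      using m_gt_1 assms(1) by simp
    ultimately obtain p where "p \<in> addresses k d" "\<forall>Y\<in>set Ys. \<not> path_resolved k p (children Y)"
      using feasible_estimator_eqI[OF assms(2), of Ys q] failure by blast
    then show "Ys \<in> (\<Union>p\<in>addresses k d. {Ys. set Ys \<inter> ?resolves p = {}})"
      by auto
  qed simp
  also have "\<dots> \<le> (\<Sum>p\<in>addresses k d. measure_pmf.prob ?P {Ys. set Ys \<inter> ?resolves p = {}})"
    by (intro measure_pmf.finite_measure_subadditive_finite finite_addresses) auto
  also have "\<dots> \<le> (\<Sum>p\<in>addresses k d. exp (- (\<alpha> ^ (k * d) * real T)))"
    by (intro sum_mono prob_replicate_pmf_avoids_le resolved)
  finally show ?thesis
    by (simp add: card_addresses)
qed

lemma prob_feasible_estimator_enough_traces: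
  fixes X :: "'a rtree"
  assumes "m \<le> k" "complete_kary k X" "0 < num_nonroot X"
  defines "n \<equiv> num_nonroot X"
  assumes enough_traces: "exp ((1 - ln \<alpha>) * real k * log (real k) (real n)) \<le> real T"
  shows "1 - real n * exp (- real n)
    \<le> measure_pmf.prob (replicate_pmf T (ted_trace q X))
        {Ys. feasible_estimator q (tree_topology X) Ys = X}"
proof -
  have "1 < k"
    using m_gt_1 assms(1) by simp
  obtain d where kary: "kary_forest k d (children X)"
    using assms(2) by (auto simp: complete_kary_def)
  with assms(3) obtain e where "d = Suc e"
    by (cases d) (auto simp: num_nonroot_def)
  then have power_le_n: "k ^ d \<le> n"
    using kary kary_forest_size by (auto simp: n_def num_nonroot_def)
  have "real n \<le> \<alpha> ^ (k * d) * exp ((1 - ln \<alpha>) * real k * log (real k) (real n))"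
    using \<alpha>_pos \<alpha>_le_1 \<open>1 < k\<close> power_le_n by (rule le_power_mult_exp_log)
  also have "\<dots> \<le> \<alpha> ^ (k * d) * real T"
    using \<alpha>_pos enough_traces by (intro mult_left_mono) auto
  finally have "real (k ^ d) * exp (- (\<alpha> ^ (k * d) * real T)) \<le> real n * exp (- real n)"
    using power_le_n by (intro mult_mono) (auto simp del: of_nat_power)
  then show ?thesis
    using prob_feasible_estimator_kary_ge[OF assms(1) kary, of T] by linarith
qed

theorem feasible_estimator_whp:
  assumes "0 < \<epsilon>"
  shows "\<exists>N. \<forall>k\<ge>m. \<forall>X :: 'a rtree. complete_kary k X \<longrightarrow> N \<le> num_nonroot X \<longrightarrow>
      (let T = nat \<lceil>exp ((1 - ln \<alpha>) * real k * log (real k) (real (num_nonroot X)))\<rceil>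
       in 1 - \<epsilon> \<le> measure_pmf.prob (replicate_pmf T (ted_trace q X))
            {Ys. feasible_estimator q (tree_topology X) Ys = X})"
proof -
  have "eventually (\<lambda>n. real n * exp (- real n) < \<epsilon> \<and> 0 < n) sequentially"
    using tendsto_mult_exp_minus \<open>0 < \<epsilon>\<close> eventually_gt_at_top
    by (intro eventually_conj order_tendstoD(2)) auto
  then obtain N where failure_le: "\<And>n. N \<le> n \<Longrightarrow> real n * exp (- real n) < \<epsilon> \<and> 0 < n"
    by (auto simp: eventually_sequentially)
  show ?thesis
    unfolding Let_def
  proof (intro exI[of _ N] allI impI)
    fix k and X :: "'a rtree"
    assume large: "m \<le> k" "complete_kary k X" "N \<le> num_nonroot X"
    let ?T = "nat \<lceil>exp ((1 - ln \<alpha>) * real k * log (real k) (real (num_nonroot X)))\<rceil>"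
    have "1 - \<epsilon> \<le> 1 - real (num_nonroot X) * exp (- real (num_nonroot X))"
      using failure_le[OF large(3)] by simp
    also have "\<dots> \<le> measure_pmf.prob (replicate_pmf ?T (ted_trace q X))
        {Ys. feasible_estimator q (tree_topology X) Ys = X}"
      using failure_le[OF large(3)] large
      by (intro prob_feasible_estimator_enough_traces real_nat_ceiling_ge) auto
    finally show "1 - \<epsilon> \<le> measure_pmf.prob (replicate_pmf ?T (ted_trace q X))
        {Ys. feasible_estimator q (tree_topology X) Ys = X}" .
  qed
qed

end

theorem theorem2:
  fixes c :: nat and q :: real
  assumes "0 < c" and "0 \<le> q" and "q < real c / (real c + 1)"
  shows "\<exists>C :: real. \<exists>est :: unit rtree \<Rightarrow> bool rtree list \<Rightarrow> bool rtree.
           \<forall>\<epsilon>::real. \<epsilon> > 0 \<longrightarrow> (\<exists>N::nat. \<forall>k::nat. k > c \<longrightarrow>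
             (\<forall>X :: bool rtree. complete_kary k X \<longrightarrow> num_nonroot X \<ge> N \<longrightarrow>
               (let T = nat \<lceil>exp (C * real k * log (real k) (real (num_nonroot X)))\<rceil>
                in measure_pmf.prob (replicate_pmf T (ted_trace q X))
                     {Ys. est (tree_topology X) Ys = X} \<ge> 1 - \<epsilon>)))"
proof -
  interpret supercritical_deletion "Suc c" q
    using assms by unfold_locales (simp_all add: field_simps)
  show ?thesis
    using feasible_estimator_whp unfolding Suc_le_eq
    by (intro exI[of _ "1 - ln \<alpha>"] exI[of _ "feasible_estimator q"]) blast
qed

end
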